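(* Let $t\ge 2$ and let $2\le p_1\le p_2\le\dots\le p_t$ be integers, and let $n$ be an integer with $n\ge \sum_{i=1}^t p_i+t-3$. Then the graph $H(n;p_1,p_2,\dots,p_t)$ is $K_{p_1}\cup\dots\cup K_{p_t}$-saturated if and only if, for every $2\le i\le t-1$, either $p_{i+1}-p_i\ge p_1$ or $p_{i+1}=p_i$.
   Context: All graphs are finite and simple. $K_m$ denotes the complete graph and $I_m$ the edgeless graph (independent set) on $m$ vertices. For vertex-disjoint graphs $G,H$, $G\cup H$ is their disjoint union and $G\lor H$ (the join) is obtained from $G\cup H$ by adding all edges between $V(G)$ and $V(H)$. For integers $2\le p_1\le\dots\le p_t$, $H(n;p_1,\dots,p_t)$ denotes the $n$-vertex graph $K_{p_1-2}\lor\bigl(K_{p_2+1}\cup\dots\cup K_{p_t+1}\cup I_{n-t+3-\sum_{i=1}^t p_i}\bigr)$. A graph $G$ is $F$-saturated if $G$ contains no subgraph isomorphic to $F$, but for every pair of nonadjacent vertices $u,v$ of $G$, the graph $G+uv$ contains a subgraph isomorphic to $F$. $K_{p_1}\cup\dots\cup K_{p_t}$ denotes the vertex-disjoint union of cliques of orders $p_1,\dots,p_t$. *)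

theory Defs
  imports Main
begin

record 'a sgraph =
  verts :: "'a set"
  edges :: "'a set set"

definition simple_graph :: "'a sgraph \<Rightarrow> bool" where
  "simple_graph G \<longleftrightarrow>
     finite (verts G) \<and> (\<forall>e\<in>edges G. e \<subseteq> verts G \<and> card e = 2)"

definition complete_graph :: "nat \<Rightarrow> nat sgraph" where
  "complete_graph m = \<lparr>verts = {..<m}, edges = {e. e \<subseteq> {..<m} \<and> card e = 2}\<rparr>"

definition edgeless_graph :: "nat \<Rightarrow> nat sgraph" where
  "edgeless_graph m = \<lparr>verts = {..<m}, edges = {}\<rparr>"

text \<open>Disjointness of the vertex sets in unions and joins is enforced by tagging
  the vertices: with \<^const>\<open>Inl\<close> and \<^const>\<open>Inr\<close> for two graphs, with the index for a
  family of graphs.\<close>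

definition disjoint_union :: "'a sgraph \<Rightarrow> 'b sgraph \<Rightarrow> ('a + 'b) sgraph" where
  "disjoint_union G H =
     \<lparr>verts = Inl ` verts G \<union> Inr ` verts H,
      edges = (\<lambda>e. Inl ` e) ` edges G \<union> (\<lambda>e. Inr ` e) ` edges H\<rparr>"

definition Disjoint_Union :: "'i set \<Rightarrow> ('i \<Rightarrow> 'a sgraph) \<Rightarrow> ('i \<times> 'a) sgraph" where
  "Disjoint_Union J G =
     \<lparr>verts = (SIGMA i:J. verts (G i)),
      edges = (\<Union>i\<in>J. (\<lambda>e. Pair i ` e) ` edges (G i))\<rparr>"

definition join :: "'a sgraph \<Rightarrow> 'b sgraph \<Rightarrow> ('a + 'b) sgraph" where
  "join G H =
     \<lparr>verts = verts (disjoint_union G H),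
      edges = edges (disjoint_union G H) \<union>
              {{Inl u, Inr v} |u v. u \<in> verts G \<and> v \<in> verts H}\<rparr>"

definition subgraph :: "'a sgraph \<Rightarrow> 'a sgraph \<Rightarrow> bool" where
  "subgraph S G \<longleftrightarrow> simple_graph S \<and> verts S \<subseteq> verts G \<and> edges S \<subseteq> edges G"

definition isomorphic :: "'a sgraph \<Rightarrow> 'b sgraph \<Rightarrow> bool" where
  "isomorphic G H \<longleftrightarrow>
     (\<exists>f. bij_betw f (verts G) (verts H) \<and>
          (\<forall>u\<in>verts G. \<forall>v\<in>verts G. {u, v} \<in> edges G \<longleftrightarrow> {f u, f v} \<in> edges H))"

definition contains_copy :: "'a sgraph \<Rightarrow> 'b sgraph \<Rightarrow> bool" where
  "contains_copy G F \<longleftrightarrow> (\<exists>S. subgraph S G \<and> isomorphic S F)"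

definition add_edge :: "'a sgraph \<Rightarrow> 'a \<Rightarrow> 'a \<Rightarrow> 'a sgraph" where
  "add_edge G u v = \<lparr>verts = verts G, edges = insert {u, v} (edges G)\<rparr>"

definition saturated :: "'b sgraph \<Rightarrow> 'a sgraph \<Rightarrow> bool" where
  "saturated F G \<longleftrightarrow>
     \<not> contains_copy G F \<and>
     (\<forall>u\<in>verts G. \<forall>v\<in>verts G. u \<noteq> v \<and> {u, v} \<notin> edges G \<longrightarrow>
        contains_copy (add_edge G u v) F)"

text \<open>The sequence \<open>p\<^sub>1, \<dots>, p\<^sub>t\<close> is a function on \<^typ>\<open>nat\<close> of which only the values on
  \<open>{1..t}\<close> matter.\<close>

definition clique_union :: "nat \<Rightarrow> (nat \<Rightarrow> nat) \<Rightarrow> (nat \<times> nat) sgraph" where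
  "clique_union t p = Disjoint_Union {1..t} (\<lambda>i. complete_graph (p i))"

text \<open>The order \<open>n - t + 3 - \<Sum>p\<^sub>i\<close> of the edgeless part is written with a single
  subtraction, which does not truncate when \<open>n \<ge> \<Sum>p\<^sub>i + t - 3\<close>.\<close>

definition H_graph :: "nat \<Rightarrow> nat \<Rightarrow> (nat \<Rightarrow> nat) \<Rightarrow> (nat + (nat \<times> nat) + nat) sgraph" where
  "H_graph n t p =
     join (complete_graph (p 1 - 2))
       (disjoint_union
          (Disjoint_Union {2..t} (\<lambda>i. complete_graph (p i + 1)))
          (edgeless_graph ((n + 3) - (t + (\<Sum>i=1..t. p i)))))"

lemma simple_complete_graph: "simple_graph (complete_graph m)"
  by (auto simp: simple_graph_def complete_graph_def)

lemma simple_edgeless_graph: "simple_graph (edgeless_graph m)"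
  by (auto simp: simple_graph_def edgeless_graph_def)

lemma simple_disjoint_union:
  assumes "simple_graph G" "simple_graph H"
  shows "simple_graph (disjoint_union G H)"
  using assms unfolding simple_graph_def disjoint_union_def
  by (simp add: ball_Un card_image) blast

lemma simple_Disjoint_Union:
  assumes "finite J" "\<And>i. i \<in> J \<Longrightarrow> simple_graph (G i)"
  shows "simple_graph (Disjoint_Union J G)"
  using assms unfolding simple_graph_def Disjoint_Union_def
  by (fastforce simp: card_image inj_on_def)

lemma simple_join:
  assumes "simple_graph G" "simple_graph H"
  shows "simple_graph (join G H)"
proof -
  have "e \<subseteq> verts (disjoint_union G H) \<and> card e = 2"
    if "e \<in> {{Inl u, Inr v} |u v. u \<in> verts G \<and> v \<in> verts H}" for e
    using that by (auto simp: disjoint_union_def)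
  with simple_disjoint_union[OF assms] show ?thesis
    unfolding simple_graph_def join_def by (simp add: ball_Un)
qed

lemma simple_clique_union: "simple_graph (clique_union t p)"
  unfolding clique_union_def
  by (intro simple_Disjoint_Union simple_complete_graph) auto

lemma simple_H_graph: "simple_graph (H_graph n t p)"
  unfolding H_graph_def
  by (intro simple_join simple_disjoint_union simple_Disjoint_Union
        simple_complete_graph simple_edgeless_graph) auto

lemma card_verts_H_graph:
  assumes "1 \<le> t" "2 \<le> p 1" "n + 3 \<ge> (\<Sum>i=1..t. p i) + t"
  shows "card (verts (H_graph n t p)) = n"
proof -
  have s: "(\<Sum>i=1..t. p i) = p 1 + (\<Sum>i=2..t. p i)"
    using assms(1) by (simp add: sum.atLeast_Suc_atMost numeral_2_eq_2)
  have "card (verts (H_graph n t p)) =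
      (p 1 - 2) + ((\<Sum>i=2..t. p i + 1) + ((n + 3) - (t + (\<Sum>i=1..t. p i))))"
    unfolding H_graph_def join_def disjoint_union_def Disjoint_Union_def
      complete_graph_def edgeless_graph_def
    by (simp add: Plus_def[symmetric] card_Plus card_SigmaI)
  also have "(\<Sum>i=2..t. p i + 1) = (\<Sum>i=2..t. p i) + (t - 1)"
    by (subst sum.distrib) simp
  also have "(p 1 - 2) + ((\<Sum>i=2..t. p i) + (t - 1) + ((n + 3) - (t + (\<Sum>i=1..t. p i)))) = n"
    using assms unfolding s by linarith
  finally show ?thesis .
qed

end

theory Submission
  imports Defs "HOL-Library.Disjoint_Sets"
begin

text \<open>Adding any missing edge \<open>uv\<close> to \<open>H(n; p\<^sub>1, \<dots>, p\<^sub>t)\<close> always creates a copy of the clique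
  union: \<open>u\<close>, \<open>v\<close> and the core \<open>K\<^bsub>p\<^sub>1 - 2\<^esub>\<close> form a clique of order \<open>p\<^sub>1\<close>, and every block
  \<open>K\<^bsub>p\<^sub>i + 1\<^esub>\<close> loses at most one vertex. So saturation only depends on whether the graph itself
  contains a copy.

  If \<open>p\<^sub>i < p\<^bsub>i+1\<^esub> < p\<^sub>i + p\<^sub>1\<close>, then block \<open>i\<close> with a part of the core hosts the clique of order
  \<open>p\<^bsub>i+1\<^esub>\<close>, and block \<open>i + 1\<close> with the rest of the core hosts those of orders \<open>p\<^sub>i\<close> and \<open>p\<^sub>1\<close>.

  Conversely, a clique of order at least \<open>p\<^sub>1\<close> lies in the core together with a single block, so a
  copy maps its \<open>t\<close> cliques to the \<open>t - 1\<close> blocks. By the gap condition no clique goes to a block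
  with a smaller \<open>p\<close>-value, and a clique that shares its block has a strictly smaller \<open>p\<close>-value than
  the block. Hence, if \<open>b\<close> is a shared block of maximal value, the cliques of order at
  least \<open>p\<^sub>b\<close> are mapped injectively to the blocks of value at least \<open>p\<^sub>b\<close> other than \<open>b\<close>, of which
  there are too few.\<close>

section \<open>Copies of a disjoint union of cliques\<close>

definition clique :: "'a sgraph \<Rightarrow> 'a set \<Rightarrow> bool" where
  "clique G C \<longleftrightarrow> C \<subseteq> verts G \<and> (\<forall>x\<in>C. \<forall>y\<in>C. x \<noteq> y \<longrightarrow> {x, y} \<in> edges G)"

definition clique_packing :: "'a sgraph \<Rightarrow> nat \<Rightarrow> (nat \<Rightarrow> nat) \<Rightarrow> (nat \<Rightarrow> 'a set) \<Rightarrow> bool" where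
  "clique_packing G t p C \<longleftrightarrow>
     (\<forall>i\<in>{1..t}. clique G (C i) \<and> card (C i) = p i) \<and> disjoint_family_on C {1..t}"

lemma isomorphic_sym:
  assumes "isomorphic G H"
  shows "isomorphic H G"
proof -
  obtain f where f: "bij_betw f (verts G) (verts H)"
    and e: "\<And>u v. u \<in> verts G \<Longrightarrow> v \<in> verts G \<Longrightarrow> {u, v} \<in> edges G \<longleftrightarrow> {f u, f v} \<in> edges H"
    using assms unfolding isomorphic_def by blast
  let ?g = "the_inv_into (verts G) f"
  have g: "bij_betw ?g (verts H) (verts G)"
    using f by (rule bij_betw_the_inv_into)
  have "{u, v} \<in> edges H \<longleftrightarrow> {?g u, ?g v} \<in> edges G" if "u \<in> verts H" "v \<in> verts H" for u v
    using e[OF bij_betwE[OF g, rule_format] bij_betwE[OF g, rule_format], OF that]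
    by (simp add: that f_the_inv_into_f_bij_betw[OF f])
  with g show ?thesis unfolding isomorphic_def by blast
qed

lemma verts_clique_union: "verts (clique_union t p) = (SIGMA i:{1..t}. {..<p i})"
  by (simp add: clique_union_def Disjoint_Union_def complete_graph_def)

lemma edge_complete_graph_iff: "{a, b} \<in> edges (complete_graph m) \<longleftrightarrow> a \<noteq> b \<and> a < m \<and> b < m"
  by (auto simp: complete_graph_def card_insert_if)

lemma edge_Disjoint_Union_iff:
  "{(i, a), (j, b)} \<in> edges (Disjoint_Union J G) \<longleftrightarrow> i = j \<and> i \<in> J \<and> {a, b} \<in> edges (G i)"
proof -
  have "{(i, a), (j, b)} = Pair m ` e \<longleftrightarrow> i = m \<and> j = m \<and> e = {a, b}" for m e
  proof
    assume eq: "{(i, a), (j, b)} = Pair m ` e"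
    then have "(i, a) \<in> Pair m ` e" "(j, b) \<in> Pair m ` e" by (metis insertI1, metis insertI1 insertI2)
    then have "i = m" "j = m" by auto
    with eq have "Pair m ` {a, b} = Pair m ` e" by simp
    then show "i = m \<and> j = m \<and> e = {a, b}"
      using \<open>i = m\<close> \<open>j = m\<close> by (metis inj_image_eq_iff inj_onI prod.inject)
  qed auto
  then show ?thesis by (auto simp: Disjoint_Union_def image_iff)
qed

lemma edge_clique_union_iff:
  assumes "x \<in> verts (clique_union t p)" "y \<in> verts (clique_union t p)"
  shows "{x, y} \<in> edges (clique_union t p) \<longleftrightarrow> x \<noteq> y \<and> fst x = fst y"
  using assms unfolding verts_clique_union
  by (cases x; cases y) (auto simp: clique_union_def edge_Disjoint_Union_iff edge_complete_graph_iff)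

lemma contains_copy_clique_union_iff:
  assumes fin: "finite (verts G)"
  shows "contains_copy G (clique_union t p) \<longleftrightarrow> (\<exists>C. clique_packing G t p C)"
proof
  assume "contains_copy G (clique_union t p)"
  then obtain S where S: "subgraph S G" and "isomorphic S (clique_union t p)"
    unfolding contains_copy_def by blast
  \<comment> \<open>Symmetry turns the isomorphism around, so that the layers of the clique union
    can be pushed forward into \<open>G\<close>.\<close>
  then obtain f where f: "bij_betw f (verts (clique_union t p)) (verts S)"
    and e: "\<And>u v. u \<in> verts (clique_union t p) \<Longrightarrow> v \<in> verts (clique_union t p) \<Longrightarrow>
        {u, v} \<in> edges (clique_union t p) \<longleftrightarrow> {f u, f v} \<in> edges S"
    using isomorphic_sym unfolding isomorphic_def by blast
  let ?K = "\<lambda>i. Pair i ` {..<p i}"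
  let ?C = "\<lambda>i. f ` ?K i"
  have K: "?K i \<subseteq> verts (clique_union t p)" if "i \<in> {1..t}" for i
    using that by (auto simp: verts_clique_union)
  have inj: "inj_on f (verts (clique_union t p))" and img: "f ` verts (clique_union t p) = verts S"
    using f by (auto simp: bij_betw_def)
  have "clique G (?C i)" if i: "i \<in> {1..t}" for i
    unfolding clique_def
  proof (intro conjI ballI impI)
    show "?C i \<subseteq> verts G" using K[OF i] img S unfolding subgraph_def by blast
    fix x y assume "x \<in> ?C i" "y \<in> ?C i" and ne: "x \<noteq> y"
    then obtain u v where uv: "u \<in> ?K i" "v \<in> ?K i" "x = f u" "y = f v" by blast
    then have "{u, v} \<in> edges (clique_union t p)"
      using K[OF i] ne by (subst edge_clique_union_iff) auto
    then have "{x, y} \<in> edges S" using uv K[OF i] e[of u v] by blast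
    then show "{x, y} \<in> edges G" using S unfolding subgraph_def by blast
  qed
  moreover have "card (?C i) = p i" if "i \<in> {1..t}" for i
    using inj_on_subset[OF inj K[OF that]] by (simp add: card_image inj_on_def)
  moreover have "disjoint_family_on ?C {1..t}"
    unfolding disjoint_family_on_def
  proof (intro ballI impI)
    fix i j assume "i \<in> {1..t}" "j \<in> {1..t}" "i \<noteq> j"
    then show "?C i \<inter> ?C j = {}"
      using inj_on_image_Int[OF inj K K, of i j] by auto
  qed
  ultimately show "\<exists>C. clique_packing G t p C"
    unfolding clique_packing_def by (intro exI[of _ ?C]) auto
next
  assume "\<exists>C. clique_packing G t p C"
  then obtain C where C: "\<And>i. i \<in> {1..t} \<Longrightarrow> clique G (C i)" "\<And>i. i \<in> {1..t} \<Longrightarrow> card (C i) = p i"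
    and dis: "disjoint_family_on C {1..t}"
    unfolding clique_packing_def by blast
  have Csub: "C i \<subseteq> verts G" if "i \<in> {1..t}" for i
    using C(1)[OF that] by (simp add: clique_def)
  have Cfin: "finite (C i)" if "i \<in> {1..t}" for i
    using Csub[OF that] fin by (rule finite_subset)
  have Cuniq: "i = j" if "x \<in> C i" "x \<in> C j" "i \<in> {1..t}" "j \<in> {1..t}" for i j x
    using dis that unfolding disjoint_family_on_def by blast
  have "\<forall>i\<in>{1..t}. \<exists>h. bij_betw h {..<p i} (C i)"
    using ex_bij_betw_nat_finite[OF Cfin] C(2) by (metis lessThan_atLeast0)
  then obtain g where g: "\<And>i. i \<in> {1..t} \<Longrightarrow> bij_betw (g i) {..<p i} (C i)"
    by metis
  \<comment> \<open>Only edges inside a single class are kept; the isomorphism has to reflect edges,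
    and \<open>G\<close> may have more of them between classes.\<close>
  define S where "S = \<lparr>verts = (\<Union>i\<in>{1..t}. C i), edges = {e. \<exists>i\<in>{1..t}. e \<subseteq> C i \<and> card e = 2}\<rparr>"
  have sub: "subgraph S G"
  proof -
    have "e \<in> edges G" if ce: "i \<in> {1..t}" "e \<subseteq> C i" "card e = 2" for i e
    proof -
      obtain x y where "e = {x, y}" "x \<noteq> y" using ce(3) by (meson card_2_iff)
      moreover have "x \<in> C i" "y \<in> C i" using ce(2) calculation by auto
      ultimately show ?thesis using C(1)[OF ce(1)] unfolding clique_def by blast
    qed
    then show ?thesis
      using Csub fin unfolding subgraph_def simple_graph_def S_def
      by (auto intro: finite_subset[OF _ fin] simp: subset_iff)
  qed
  let ?h = "\<lambda>(i, k). g i k"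
  have hC: "?h x \<in> C (fst x)" "fst x \<in> {1..t}" if "x \<in> verts (clique_union t p)" for x
    using that bij_betwE[OF g[of "fst x"]] by (auto simp: verts_clique_union)
  have inj: "inj_on ?h (verts (clique_union t p))"
  proof (rule inj_onI)
    fix x y assume xy: "x \<in> verts (clique_union t p)" "y \<in> verts (clique_union t p)" "?h x = ?h y"
    then have *: "fst x = fst y" using hC[of x] hC[of y] Cuniq by metis
    with xy have "snd x = snd y"
      using inj_onD[OF bij_betw_imp_inj_on[OF g[of "fst x"]], of "snd x" "snd y"]
      by (auto simp: verts_clique_union)
    with * show "x = y" by (simp add: prod_eq_iff)
  qed
  have "bij_betw ?h (verts (clique_union t p)) (verts S)"
    unfolding bij_betw_def
  proof (intro conjI inj set_eqI iffI)
    fix x assume "x \<in> ?h ` verts (clique_union t p)"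
    then obtain w where "w \<in> verts (clique_union t p)" "x = ?h w" by blast
    then show "x \<in> verts S" using hC[of w] unfolding S_def by auto
  next
    fix x assume "x \<in> verts S"
    then obtain i where i: "i \<in> {1..t}" "x \<in> C i" by (auto simp: S_def)
    then obtain k where "k < p i" "x = g i k" using g[OF i(1)] by (auto simp: bij_betw_def)
    then have "(i, k) \<in> verts (clique_union t p)" "x = ?h (i, k)" using i by (auto simp: verts_clique_union)
    then show "x \<in> ?h ` verts (clique_union t p)" by blast
  qed
  moreover have "{u, v} \<in> edges (clique_union t p) \<longleftrightarrow> {?h u, ?h v} \<in> edges S"
    if uv: "u \<in> verts (clique_union t p)" "v \<in> verts (clique_union t p)" for u v
  proof -
    have "u \<noteq> v \<longleftrightarrow> ?h u \<noteq> ?h v" using inj uv by (auto dest: inj_onD)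
    also have "\<dots> \<longleftrightarrow> card {?h u, ?h v} = 2" by (simp add: card_insert_if)
    finally have 1: "u \<noteq> v \<longleftrightarrow> card {?h u, ?h v} = 2" .
    have 2: "fst u = fst v \<longleftrightarrow> (\<exists>i\<in>{1..t}. {?h u, ?h v} \<subseteq> C i)"
      using hC[OF uv(1)] hC[OF uv(2)] Cuniq by (metis empty_subsetI insert_subset)
    show ?thesis
      unfolding edge_clique_union_iff[OF uv] 1 2 by (auto simp: S_def)
  qed
  ultimately have "isomorphic (clique_union t p) S" unfolding isomorphic_def by blast
  then show "contains_copy G (clique_union t p)"
    using sub isomorphic_sym unfolding contains_copy_def by blast
qed

section \<open>Cliques of the graph \<open>H\<close>\<close>

definition core :: "(nat \<Rightarrow> nat) \<Rightarrow> (nat + (nat \<times> nat) + nat) set" where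
  "core p = Inl ` {..<p 1 - 2}"

definition block :: "(nat \<Rightarrow> nat) \<Rightarrow> nat \<Rightarrow> (nat + (nat \<times> nat) + nat) set" where
  "block p i = (\<lambda>k. Inr (Inl (i, k))) ` {..<p i + 1}"

lemma finite_core [simp]: "finite (core p)" and card_core [simp]: "card (core p) = p 1 - 2"
  by (simp_all add: core_def card_image)

lemma finite_block [simp]: "finite (block p i)" and card_block [simp]: "card (block p i) = p i + 1"
  by (simp_all add: block_def card_image inj_on_def)

lemma core_block_disjoint: "core p \<inter> block p i = {}"
  by (auto simp: core_def block_def)

lemma block_disjoint: "i \<noteq> j \<Longrightarrow> block p i \<inter> block p j = {}"
  by (auto simp: block_def)

lemma core_subset: "core p \<subseteq> verts (H_graph n t p)"
  by (auto simp: core_def H_graph_def join_def disjoint_union_def complete_graph_def)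

lemma block_subset: "i \<in> {2..t} \<Longrightarrow> block p i \<subseteq> verts (H_graph n t p)"
  by (auto simp: block_def H_graph_def join_def disjoint_union_def Disjoint_Union_def complete_graph_def)

lemma edge_disjoint_union_iff:
  fixes G :: "'u sgraph" and H :: "'v sgraph"
  shows
  "{Inl a, Inl b} \<in> edges (disjoint_union G H) \<longleftrightarrow> {a, b} \<in> edges G"
  "{Inr c, Inr d} \<in> edges (disjoint_union G H) \<longleftrightarrow> {c, d} \<in> edges H"
  "{Inl a, Inr d} \<notin> edges (disjoint_union G H)"
proof -
  have Inl_Inr: "{Inl x, z} \<noteq> Inr ` e" for x :: 'u and z :: "'u + 'v" and e by (auto dest: equalityD1)
  have Inr_Inl: "{z, Inr x} \<noteq> Inl ` e" for x :: 'v and z :: "'u + 'v" and e by (auto dest: equalityD1)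
  \<comment> \<open>Taking images under an injective tag is itself injective on sets, so the tag
    cancels.\<close>
  have "{Inl a, Inl b} \<in> (`) Inl ` E \<longleftrightarrow> {a, b} \<in> E" for E
    using inj_image_mem_iff[OF inj_on_image[of Inl UNIV], of "{a, b}" E] by simp
  then show "{Inl a, Inl b} \<in> edges (disjoint_union G H) \<longleftrightarrow> {a, b} \<in> edges G"
    using Inl_Inr by (auto simp: disjoint_union_def)
  have "{Inr c, Inr d} \<in> (`) Inr ` E \<longleftrightarrow> {c, d} \<in> E" for E
    using inj_image_mem_iff[OF inj_on_image[of Inr UNIV], of "{c, d}" E] by simp
  then show "{Inr c, Inr d} \<in> edges (disjoint_union G H) \<longleftrightarrow> {c, d} \<in> edges H"
    using Inr_Inl by (auto simp: disjoint_union_def)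
  show "{Inl a, Inr d} \<notin> edges (disjoint_union G H)"
    by (simp add: disjoint_union_def image_iff Inl_Inr Inr_Inl)
qed

lemma edge_join_iff:
  "{Inl a, Inl b} \<in> edges (join G H) \<longleftrightarrow> {a, b} \<in> edges G"
  "{Inr c, Inr d} \<in> edges (join G H) \<longleftrightarrow> {c, d} \<in> edges H"
  "{Inl a, Inr d} \<in> edges (join G H) \<longleftrightarrow> a \<in> verts G \<and> d \<in> verts H"
  by (auto simp: join_def edge_disjoint_union_iff doubleton_eq_iff)

text \<open>Unfolds the tagged construction once and for all: core vertices see everything, blocks
  are cliques, and a vertex in neither comes from the edgeless part and sees only the core.\<close>

lemma edge_H_graph_iff:
  assumes "x \<in> verts (H_graph n t p)" "y \<in> verts (H_graph n t p)"
  shows "{x, y} \<in> edges (H_graph n t p) \<longleftrightarrow>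
    x \<noteq> y \<and> (x \<in> core p \<or> y \<in> core p \<or> (\<exists>i\<in>{2..t}. x \<in> block p i \<and> y \<in> block p i))"
proof -
  have verts: "verts (join G H) = Inl ` verts G \<union> Inr ` verts H"
    "verts (disjoint_union G H) = Inl ` verts G \<union> Inr ` verts H"
    "verts (Disjoint_Union J F) = (SIGMA i:J. verts (F i))"
    "verts (complete_graph m) = {..<m}" for G :: "'g sgraph" and H :: "'h sgraph" and J :: "'i set"
      and F :: "'i \<Rightarrow> 'f sgraph" and m
    by (simp_all add: join_def disjoint_union_def Disjoint_Union_def complete_graph_def)
  \<comment> \<open>Brings mixed pairs into the orientation used by
    \<open>edge_join_iff\<close>.\<close>
  have commute: "{Inr d, Inl a} = {Inl a, Inr d}" for a :: 'g and d :: 'h by auto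
  have edgeless: "e \<notin> edges (edgeless_graph m)" for e m
    by (simp add: edgeless_graph_def)
  have loop: "{z} \<notin> edges (H_graph n t p)" for z
    using simple_H_graph[of n t p] by (auto simp: simple_graph_def)
  show ?thesis
  proof (cases "x = y")
    case True
    then show ?thesis using loop by simp
  next
    case False
    then show ?thesis
      using assms
      by (auto simp: H_graph_def verts edge_join_iff edge_disjoint_union_iff edge_Disjoint_Union_iff
          edge_complete_graph_iff edgeless commute core_def block_def)
  qed
qed

lemma clique_H_graphI:
  assumes "i \<in> {2..t}" "C \<subseteq> core p \<union> block p i"
  shows "clique (H_graph n t p) C"
  unfolding clique_def
proof (intro conjI ballI impI)
  show sub: "C \<subseteq> verts (H_graph n t p)"
    using assms core_subset block_subset by blast
  fix x y assume "x \<in> C" "y \<in> C" "x \<noteq> y"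
  with sub assms show "{x, y} \<in> edges (H_graph n t p)"
    by (subst edge_H_graph_iff) blast+
qed

text \<open>The core has \<open>p 1 - 2\<close> vertices, so at least two vertices of
  \<open>C\<close> lie outside it. Adjacent vertices outside the core share a block, and since
  blocks are disjoint, one block serves for all of them.\<close>

lemma clique_H_graphE:
  assumes C: "clique (H_graph n t p) C" and large: "p 1 \<le> card C" and p1: "2 \<le> p 1"
  obtains i where "i \<in> {2..t}" "C \<subseteq> core p \<union> block p i"
proof -
  have adj: "\<exists>i\<in>{2..t}. x \<in> block p i \<and> y \<in> block p i"
    if "x \<in> C - core p" "y \<in> C - core p" "x \<noteq> y" for x y
    using that C edge_H_graph_iff[of x n t p y] unfolding clique_def by blast
  have "card C - card (core p) \<le> card (C - core p)" by (rule diff_card_le_card_Diff) simp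
  then have "2 \<le> card (C - core p)" using large p1 by simp
  then obtain T where "T \<subseteq> C - core p" "card T = 2" by (rule obtain_subset_with_card_n)
  then obtain x y where xy: "x \<in> C - core p" "y \<in> C - core p" "x \<noteq> y"
    by (auto simp: card_2_iff)
  then obtain i where i: "i \<in> {2..t}" "x \<in> block p i" using adj by blast
  have "z \<in> block p i" if "z \<in> C - core p" for z
  proof (cases "z = x")
    case False
    then obtain j where "x \<in> block p j" "z \<in> block p j" using adj xy(1) \<open>z \<in> C - core p\<close> by blast
    then show ?thesis using block_disjoint[of i j p] i(2) by blast
  qed (use i in simp)
  then show thesis using that i(1) by blast
qed

section \<open>Clique packings in \<open>H\<close> and in \<open>H\<close> with an added
  edge\<close>

lemma clique_packing_add_edge_H_graph:
  assumes p1: "2 \<le> p 1"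
    and uv: "u \<in> verts (H_graph n t p)" "v \<in> verts (H_graph n t p)" "u \<noteq> v"
      "{u, v} \<notin> edges (H_graph n t p)"
  shows "\<exists>C. clique_packing (add_edge (H_graph n t p) u v) t p C"
proof -
  let ?G = "add_edge (H_graph n t p) u v"
  have mono: "clique ?G C" if "clique (H_graph n t p) C" for C
    using that by (auto simp: clique_def add_edge_def)
  have notcore: "u \<notin> core p" "v \<notin> core p"
    and notblock: "\<And>i. i \<in> {2..t} \<Longrightarrow> \<not> (u \<in> block p i \<and> v \<in> block p i)"
    using uv edge_H_graph_iff[OF uv(1,2)] by blast+
  have "\<exists>D. D \<subseteq> block p i - {u, v} \<and> card D = p i" if i: "i \<in> {2..t}" for i
  proof -
    \<comment> \<open>At most one of \<open>u\<close>, \<open>v\<close> is in the block, and its one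
      vertex beyond \<open>p i\<close> makes up for the loss.\<close>
    have "block p i - {u, v} = block p i - {u} \<or> block p i - {u, v} = block p i - {v}"
      using notblock[OF i] by blast
    moreover have "p i \<le> card (block p i - {w})" for w
      by (simp add: card_Diff_singleton_if)
    ultimately have "p i \<le> card (block p i - {u, v})" by metis
    then obtain D where "D \<subseteq> block p i - {u, v}" "card D = p i"
      by (rule obtain_subset_with_card_n)
    then show ?thesis by blast
  qed
  then obtain D where D: "\<And>i. i \<in> {2..t} \<Longrightarrow> D i \<subseteq> block p i - {u, v}"
      "\<And>i. i \<in> {2..t} \<Longrightarrow> card (D i) = p i"
    by metis
  let ?K = "core p \<union> {u, v}"
  let ?C = "\<lambda>i. if i = 1 then ?K else D i"
  have "clique ?G ?K"
    unfolding clique_def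
  proof (intro conjI ballI impI)
    show sub: "?K \<subseteq> verts ?G" using uv core_subset by (auto simp: add_edge_def)
    fix x y assume xy: "x \<in> ?K" "y \<in> ?K" "x \<noteq> y"
    show "{x, y} \<in> edges ?G"
    proof (cases "x \<in> core p \<or> y \<in> core p")
      case True
      then have "{x, y} \<in> edges (H_graph n t p)"
        using xy sub by (subst edge_H_graph_iff) (auto simp: add_edge_def)
      then show ?thesis by (simp add: add_edge_def)
    next
      case False
      then have "{x, y} = {u, v}" using xy by blast
      then show ?thesis by (simp add: add_edge_def)
    qed
  qed
  moreover have "card ?K = p 1"
    using notcore uv(3) p1 by (simp add: card_insert_if)
  moreover have "clique ?G (D i)" if "i \<in> {2..t}" for i
    using D(1)[OF that] that by (intro mono clique_H_graphI[of i]) blast+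
  moreover have "disjoint_family_on ?C {1..t}"
    unfolding disjoint_family_on_def
  proof (intro ballI impI)
    have KD: "?K \<inter> D i = {}" if "i \<in> {2..t}" for i
      using D(1)[OF that] core_block_disjoint[of p i] by blast
    have DD: "D i \<inter> D j = {}" if "i \<in> {2..t}" "j \<in> {2..t}" "i \<noteq> j" for i j
      using D(1)[OF that(1)] D(1)[OF that(2)] block_disjoint[OF that(3), of p] by blast
    fix i j assume ij: "i \<in> {1..t}" "j \<in> {1..t}" "i \<noteq> j"
    consider "i = 1" "j \<in> {2..t}" | "j = 1" "i \<in> {2..t}" | "i \<in> {2..t}" "j \<in> {2..t}"
      using ij by force
    then show "?C i \<inter> ?C j = {}"
      using KD[of i] KD[of j] DD[of i j] ij(3) by cases auto
  qed
  ultimately have "clique_packing ?G t p ?C"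
    using D(2) by (auto simp: clique_packing_def)
  then show ?thesis by blast
qed

text \<open>The fit is exact: the core and blocks \<open>i\<close> and \<open>i + 1\<close> have
  \<open>p 1 + p i + p (i + 1)\<close> vertices together, the total order of the three cliques
  placed there.\<close>

lemma clique_packing_H_graph_of_small_gap:
  assumes p1: "2 \<le> p 1" and i: "2 \<le> i" "i < t"
    and gap: "p i < p (i + 1)" "p (i + 1) < p i + p 1"
  shows "\<exists>C. clique_packing (H_graph n t p) t p C"
proof -
  \<comment> \<open>\<open>A\<close> fills block \<open>i\<close>, of order \<open>p i + 1\<close>,
    up to \<open>p (i + 1)\<close> vertices; the upper bound on the gap says that the core is large
    enough.\<close>
  obtain A where A: "A \<subseteq> core p" "card A = p (i + 1) - p i - 1"
  proof -
    have "p (i + 1) - p i - 1 \<le> card (core p)" using gap by simp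
    then show thesis using obtain_subset_with_card_n that by metis
  qed
  have finA: "finite A" using A(1) finite_core by (rule finite_subset)
  define X where "X = A \<union> block p i"
  define Y where "Y = (core p - A) \<union> block p (i + 1)"
  have cX: "card X = p (i + 1)"
    unfolding X_def using A gap finA core_block_disjoint[of p i]
    by (subst card_Un_disjoint) auto
  have cY: "card Y = p 1 + p i"
    unfolding Y_def using A gap finA p1 core_block_disjoint[of p "i + 1"]
    by (subst card_Un_disjoint) (auto simp: card_Diff_subset)
  obtain Z where Z: "Z \<subseteq> Y" "card Z = p 1"
    using obtain_subset_with_card_n[of "p 1" Y] cY by auto
  have finY: "finite Y" by (simp add: Y_def)
  have cYZ: "card (Y - Z) = p i"
    using Z cY finite_subset[OF Z(1) finY] by (simp add: card_Diff_subset)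
  have "\<exists>D. D \<subseteq> block p k \<and> card D = p k" for k
    using obtain_subset_with_card_n[of "p k" "block p k"] by auto
  then obtain D where D: "\<And>k. D k \<subseteq> block p k" "\<And>k. card (D k) = p k"
    by metis
  \<comment> \<open>Cliques \<open>i\<close> and \<open>i + 1\<close> swap blocks, clique
    \<open>1\<close> joins clique \<open>i\<close>, and all others stay in their own blocks.\<close>
  define C where "C = (\<lambda>k. if k = 1 then Z else if k = i then Y - Z else if k = i + 1 then X else D k)"
  have "clique (H_graph n t p) (C k) \<and> card (C k) = p k" if k: "k \<in> {1..t}" for k
  proof -
    have "clique (H_graph n t p) Z" "clique (H_graph n t p) (Y - Z)"
      using i Z by (auto intro!: clique_H_graphI[of "i + 1"] simp: Y_def)
    moreover have "clique (H_graph n t p) X"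
      using i A by (auto intro!: clique_H_graphI[of i] simp: X_def)
    moreover have "clique (H_graph n t p) (D k)" if "k \<noteq> 1"
      using k that D(1)[of k] by (intro clique_H_graphI[of k]) auto
    ultimately show ?thesis using cX cYZ Z(2) D(2) by (simp add: C_def)
  qed
  moreover have "disjoint_family_on C {1..t}"
    unfolding disjoint_family_on_def
  proof (intro ballI impI)
    have XY: "X \<inter> Y = {}"
      using A(1) core_block_disjoint[of p i] core_block_disjoint[of p "i + 1"]
        block_disjoint[of i "i + 1" p] by (auto simp: X_def Y_def)
    have XD: "X \<inter> D k = {}" if "k \<noteq> i" for k
      using A(1) D(1)[of k] core_block_disjoint[of p k] block_disjoint[OF that, of p]
      by (auto simp: X_def)
    have YD: "Y \<inter> D k = {}" if "k \<noteq> i + 1" for k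
      using D(1)[of k] core_block_disjoint[of p k] block_disjoint[OF that, of p]
      by (auto simp: Y_def)
    have DD: "D k \<inter> D l = {}" if "k \<noteq> l" for k l
      using D(1)[of k] D(1)[of l] block_disjoint[OF that, of p] by blast
    have "Z \<inter> D k = {}" "(Y - Z) \<inter> D k = {}" if "k \<noteq> i + 1" for k
      using YD[OF that] Z(1) by blast+
    moreover have "X \<inter> Z = {}" "X \<inter> (Y - Z) = {}" using XY Z(1) by blast+
    moreover fix k l :: nat assume "k \<noteq> l"
    ultimately show "C k \<inter> C l = {}"
      using XD[of k] XD[of l] DD[of k l] unfolding C_def by (simp add: Int_commute)
  qed
  ultimately show ?thesis unfolding clique_packing_def by blast
qed

text \<open>The hypotheses compare values of \<open>p\<close> rather than positions, so blocks of
  equal value need no separate treatment in the counting.\<close>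

lemma no_clique_packing_H_graph:
  assumes p1: "2 \<le> p 1"
    and p1_le: "\<And>i. i \<in> {1..t} \<Longrightarrow> p 1 \<le> p i"
    and gap: "\<And>i j. i \<in> {2..t} \<Longrightarrow> j \<in> {2..t} \<Longrightarrow> p i < p j \<Longrightarrow> p i + p 1 \<le> p j"
    and t: "1 \<le> t"
  shows "\<not> clique_packing (H_graph n t p) t p C"
proof
  assume "clique_packing (H_graph n t p) t p C"
  then have C: "\<And>i. i \<in> {1..t} \<Longrightarrow> clique (H_graph n t p) (C i)" "\<And>i. i \<in> {1..t} \<Longrightarrow> card (C i) = p i"
    and dis: "\<And>i j. i \<in> {1..t} \<Longrightarrow> j \<in> {1..t} \<Longrightarrow> i \<noteq> j \<Longrightarrow> C i \<inter> C j = {}"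
    by (auto simp: clique_packing_def disjoint_family_on_def)
  have "\<exists>b\<in>{2..t}. C i \<subseteq> core p \<union> block p b" if "i \<in> {1..t}" for i
    using clique_H_graphE[OF C(1)[OF that] _ p1] p1_le[OF that] C(2)[OF that] by metis
  then obtain f where f: "\<And>i. i \<in> {1..t} \<Longrightarrow> f i \<in> {2..t}"
      "\<And>i. i \<in> {1..t} \<Longrightarrow> C i \<subseteq> core p \<union> block p (f i)"
    by metis
  \<comment> \<open>One vertex short of \<open>p b + p 1\<close>: this is what rules out both a
    clique a full gap larger than the block value and two cliques of orders \<open>p b\<close> and
    \<open>p 1\<close>.\<close>
  have room: "card (core p \<union> block p b) = p b + p 1 - 1" for b
    using p1 by (subst card_Un_disjoint) (auto simp: core_block_disjoint)
  have fin: "finite (core p \<union> block p b)" for b by simp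
  \<comment> \<open>Otherwise the gap condition would give \<open>p i\<close> at least
    \<open>p (f i) + p 1\<close>, beyond the room. Index \<open>1\<close> is outside the gap
    condition, but has the least value.\<close>
  have le: "p i \<le> p (f i)" if i: "i \<in> {1..t}" for i
  proof (cases "i = 1")
    case True
    then show ?thesis using p1_le[of "f i"] f(1)[OF i] by auto
  next
    case False
    have "p i \<le> p (f i) + p 1 - 1"
      using card_mono[OF fin f(2)[OF i]] C(2)[OF i] room by simp
    then show ?thesis using gap[of "f i" i] f(1)[OF i] i False p1 by force
  qed
  have less: "p i < p (f i)" if ij: "i \<in> {1..t}" "j \<in> {1..t}" "i \<noteq> j" "f i = f j" for i j
  proof -
    have fc: "finite (C i)" "finite (C j)" using f(2) ij(1,2) fin by (meson finite_subset)+
    have "card (C i \<union> C j) \<le> card (core p \<union> block p (f i))"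
      using f(2)[OF ij(1)] f(2)[OF ij(2)] ij(4) by (intro card_mono fin) auto
    then have "p i + p j \<le> p (f i) + p 1 - 1"
      using card_Un_disjoint[OF fc dis[OF ij(1-3)]] C(2) ij room by simp
    then show ?thesis using p1_le[OF ij(2)] p1 by linarith
  qed
  \<comment> \<open>The shared blocks; some exist because \<open>f\<close> maps \<open>t\<close>
    indices into \<open>t - 1\<close>.\<close>
  define S where "S = {b. \<exists>i\<in>{1..t}. \<exists>j\<in>{1..t}. i \<noteq> j \<and> f i = b \<and> f j = b}"
  have "\<not> inj_on f {1..t}"
  proof
    assume "inj_on f {1..t}"
    then have "card {1..t} \<le> card {2..t}" using f(1) by (intro card_inj_on_le) auto
    then show False using t by simp
  qed
  then have "S \<noteq> {}" unfolding inj_on_def S_def by auto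
  moreover have finS: "finite S"
    by (rule finite_subset[of _ "{2..t}"]) (use f(1) in \<open>auto simp: S_def\<close>)
  ultimately have "Max (p ` S) \<in> p ` S" by simp
  then obtain b where b: "b \<in> S" "p b = Max (p ` S)" by auto
  have max: "p c \<le> p b" if "c \<in> S" for c
    using that finS b(2) by simp
  obtain i j where ij: "i \<in> {1..t}" "j \<in> {1..t}" "i \<noteq> j" "f i = b" "f j = b"
    using b(1) unfolding S_def by blast
  have bt: "b \<in> {2..t}" using f(1)[OF ij(1)] ij(4) by simp
  let ?U = "{k \<in> {1..t}. p b \<le> p k}" and ?V = "{k \<in> {2..t}. p b \<le> p k}"
  have "inj_on f ?U"
  proof (rule inj_onI, rule ccontr)
    fix k l assume kl: "k \<in> ?U" "l \<in> ?U" "f k = f l" "k \<noteq> l"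
    then have "k \<in> {1..t}" "l \<in> {1..t}" by simp_all
    with kl(3,4) have "f k \<in> S" unfolding S_def by force
    then have "p (f k) \<le> p b" by (rule max)
    \<comment> \<open>A collision within \<open>?U\<close> would be a shared block of value above
      \<open>p b\<close>, against the choice of \<open>b\<close>.\<close>
    moreover have "p k < p (f k)" using kl by (intro less[of k l]) auto
    ultimately show False using kl by auto
  qed
  moreover have "f ` ?U \<subseteq> ?V - {b}"
  proof (intro image_subsetI)
    fix k assume k: "k \<in> ?U"
    have "f k \<noteq> b"
    proof
      assume "f k = b"
      then have "p k < p b"
        \<comment> \<open>At least one of \<open>i\<close>, \<open>j\<close> differs from
          \<open>k\<close> and shares block \<open>b\<close> with it.\<close>
        using less[of k i] less[of k j] k ij by (cases "k = i") auto
      with k show False by simp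
    qed
    then show "f k \<in> ?V - {b}" using k f(1)[of k] le[of k] by auto
  qed
  ultimately have "card ?U \<le> card (?V - {b})" by (intro card_inj_on_le) auto
  also have "\<dots> < card ?V" using bt by (intro card_Diff1_less) auto
  \<comment> \<open>\<open>?V\<close> is contained in \<open>?U\<close>, which closes the cycle of
    inequalities.\<close>
  also have "\<dots> \<le> card ?U" by (intro card_mono) auto
  finally show False by simp
qed

theorem theorem1p1:
  fixes n t :: nat and p :: "nat \<Rightarrow> nat"
  assumes "t \<ge> 2"
    and "2 \<le> p 1"
    and "\<And>i. 1 \<le> i \<Longrightarrow> i < t \<Longrightarrow> p i \<le> p (i + 1)"
    and "int n \<ge> (\<Sum>i=1..t. int (p i)) + int t - 3"
  shows "saturated (clique_union t p) (H_graph n t p) \<longleftrightarrow>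
    (\<forall>i. 2 \<le> i \<and> i \<le> t - 1 \<longrightarrow> p (i + 1) - p i \<ge> p 1 \<or> p (i + 1) = p i)"
proof -
  let ?H = "H_graph n t p"
  have fin: "finite (verts ?H)" "finite (verts (add_edge ?H u v))" for u v
    using simple_H_graph[of n t p] by (simp_all add: simple_graph_def add_edge_def)
  \<comment> \<open>The condition on added edges always holds, so only the absence of a copy
    remains.\<close>
  have "saturated (clique_union t p) ?H \<longleftrightarrow> (\<nexists>C. clique_packing ?H t p C)"
    unfolding saturated_def contains_copy_clique_union_iff[OF fin(1)]
      contains_copy_clique_union_iff[OF fin(2)]
    using clique_packing_add_edge_H_graph[of p, OF assms(2)] by blast
  also have "\<dots> \<longleftrightarrow> (\<forall>i. 2 \<le> i \<and> i \<le> t - 1 \<longrightarrow> p (i + 1) - p i \<ge> p 1 \<or> p (i + 1) = p i)"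
  proof (intro iffI allI impI)
    fix i assume none: "\<nexists>C. clique_packing ?H t p C" and i: "2 \<le> i \<and> i \<le> t - 1"
    show "p (i + 1) - p i \<ge> p 1 \<or> p (i + 1) = p i"
    proof (rule ccontr)
      assume "\<not> ?thesis"
      then have "p i < p (i + 1)" "p (i + 1) < p i + p 1"
        using assms(3)[of i] i assms(1) by linarith+
      moreover have "i < t" using i assms(1) by linarith
      ultimately show False
        using clique_packing_H_graph_of_small_gap[of p i t n, OF assms(2)] i none by blast
    qed
  next
    assume gaps: "\<forall>i. 2 \<le> i \<and> i \<le> t - 1 \<longrightarrow> p (i + 1) - p i \<ge> p 1 \<or> p (i + 1) = p i"
    have mono: "p i \<le> p j" if "i \<le> j" "1 \<le> i" "j \<le> t" for i j
      using that
    proof (induction j rule: dec_induct)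
      case (step j)
      then show ?case using assms(3)[of j] by simp
    qed simp
    \<comment> \<open>From neighbours to all pairs: each step keeps the value or raises it by at
      least \<open>p 1\<close>. Monotonicity makes the truncated difference exact.\<close>
    have gap: "p i = p j \<or> p i + p 1 \<le> p j" if "i \<le> j" "2 \<le> i" "j \<le> t" for i j
      using that
    proof (induction j rule: dec_induct)
      case (step j)
      then have "p (j + 1) - p j \<ge> p 1 \<or> p (j + 1) = p j" using gaps by auto
      moreover have "p j \<le> p (j + 1)" using assms(3)[of j] step by simp
      moreover have "p i = p j \<or> p i + p 1 \<le> p j" using step by simp
      ultimately show ?case using assms(2) by auto
    qed simp
    have "p i + p 1 \<le> p j" if "i \<in> {2..t}" "j \<in> {2..t}" "p i < p j" for i j
      using that gap[of i j] mono[of j i] by (cases "i \<le> j") auto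
    then show "\<nexists>C. clique_packing ?H t p C"
      using no_clique_packing_H_graph[of p t n] assms(1,2) mono[of 1] by auto
  qed
  finally show ?thesis .
qed

end
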